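(* In the weighted graph setting described in the context, the Neumann-Poincaré operator $D'$ has a real spectrum (all complex eigenvalues of the matrix $D'$ are real).
   Context: Graph. $\mathcal G=(\mathcal V,\mathcal E)$ is a finite connected undirected graph without self-edges. $\mathcal V$ is partitioned into four nonempty disjoint sets $B,\Omega^+,\partial\Omega,\Omega^-$ such that, among pairs of distinct sets of the partition, the only ones joined by at least one edge are $\{B,\Omega^+\}$, $\{\Omega^+,\partial\Omega\}$, $\{\partial\Omega,\Omega^-\}$ (so there are no edges between $B$ and $\partial\Omega$, $B$ and $\Omega^-$, or $\Omega^+$ and $\Omega^-$). Put $\mathcal V^\circ=\mathcal V\setminus B$. Laplacian. The discrete gradient $\nabla$ is the $|\mathcal E|\times|\mathcal V|$ matrix with $(\nabla u)_k=u_i-u_j$, where $i,j$ are the endpoints of edge $k$ in a fixed order. For $s\in[0,\infty)^{|\mathcal E|}$, $L(s)=\nabla^T\mathrm{diag}(s)\nabla$. A conductivity $\sigma\in(0,\infty)^{|\mathcal E|}$ is fixed. $L[X,Y]$ denotes the submatrix with rows $X$, columns $Y$; $R_X$ is the $|X|\times|\mathcal V|$ matrix with $R_Xu=u|_X$. Green function. $G=R_{\mathcal V^\circ}^T\,L(\sigma)[\mathcal V^\circ,\mathcal V^\circ]^{-1}R_{\mathcal V^\circ}$ (the inverse exists since $\mathcal G$ is connected). Edge partition of unity. Let $\mathcal E^+$ be the edges with at least one node in $B\cup\Omega^+$ and $\mathcal E^-$ the edges with at least one node in $\Omega^-$. Fix any $p^+,p^-\in[0,1]^{|\mathcal E|}$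 with $p^++p^-=1$, $p^+|_{\mathcal E^+}=1$, $p^-|_{\mathcal E^-}=1$. Set $\sigma^\pm=p^\pm\sigma$ (componentwise), so $L(\sigma)=L(\sigma^+)+L(\sigma^-)$. Operators. $\gamma_0=R_{\partial\Omega}$, $\gamma_1^\pm=\mp R_{\partial\Omega}L(\sigma^\pm)$, $\mathcal S=G\gamma_0^T$. The Neumann-Poincaré (adjoint double layer) operator is the $|\partial\Omega|\times|\partial\Omega|$ matrix $D'=\frac12(\gamma_1^++\gamma_1^-)\mathcal S$. *)

theory Defs
  imports
    "Graph_Theory.Pair_Digraph"
    "Graph_Theory.Digraph_Component"
    "Jordan_Normal_Form.DL_Submatrix"
    "Jordan_Normal_Form.Gauss_Jordan_Elimination"
    "Jordan_Normal_Form.Spectral_Radius"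
begin

text \<open>
  An undirected graph without self-edges is a \<open>pair_graph\<close>: each undirected edge is represented
  by its two opposite arcs.  Vectors and matrices over the vertices (edges) are indexed through an
  enumeration \<open>vs\<close> of the vertices (\<open>es\<close> of the edges); entry \<open>k\<close> of \<open>es\<close> lists the endpoints of
  the \<open>k\<close>-th edge in their fixed order.
\<close>

definition vertex_enum :: "'a pair_pre_digraph \<Rightarrow> 'a list \<Rightarrow> bool" where
  "vertex_enum G vs \<longleftrightarrow> distinct vs \<and> set vs = pverts G"

text \<open>Every undirected edge occurs exactly once, in exactly one of its two orientations.\<close>

definition edge_enum :: "'a pair_pre_digraph \<Rightarrow> ('a \<times> 'a) list \<Rightarrow> bool" where
  "edge_enum G es \<longleftrightarrow> distinct es \<and> set es \<inter> (set es)\<inverse> = {} \<and> set es \<union> (set es)\<inverse> = parcs G"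

definition joined :: "'a pair_pre_digraph \<Rightarrow> 'a set \<Rightarrow> 'a set \<Rightarrow> bool" where
  "joined G X Y \<longleftrightarrow> (\<exists>x\<in>X. \<exists>y\<in>Y. (x, y) \<in> parcs G)"

definition partition4 :: "'a pair_pre_digraph \<Rightarrow> 'a set \<Rightarrow> 'a set \<Rightarrow> 'a set \<Rightarrow> 'a set \<Rightarrow> bool" where
  "partition4 G B Op bd Om \<longleftrightarrow>
     B \<noteq> {} \<and> Op \<noteq> {} \<and> bd \<noteq> {} \<and> Om \<noteq> {} \<and>
     B \<inter> Op = {} \<and> B \<inter> bd = {} \<and> B \<inter> Om = {} \<and>
     Op \<inter> bd = {} \<and> Op \<inter> Om = {} \<and> bd \<inter> Om = {} \<and>
     B \<union> Op \<union> bd \<union> Om = pverts G \<and>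
     joined G B Op \<and> joined G Op bd \<and> joined G bd Om \<and>
     \<not> joined G B bd \<and> \<not> joined G B Om \<and> \<not> joined G Op Om"

text \<open>Edge number \<open>k\<close> has at least one node in \<open>X\<close>.\<close>

definition edge_touches :: "('a \<times> 'a) list \<Rightarrow> nat \<Rightarrow> 'a set \<Rightarrow> bool" where
  "edge_touches es k X \<longleftrightarrow> fst (es ! k) \<in> X \<or> snd (es ! k) \<in> X"

definition vertex_indices :: "'a list \<Rightarrow> 'a set \<Rightarrow> nat set" where
  "vertex_indices vs X = {i. i < length vs \<and> vs ! i \<in> X}"

definition restr :: "'a list \<Rightarrow> 'a set \<Rightarrow> real mat" where
  "restr vs X = submatrix (1\<^sub>m (length vs)) (vertex_indices vs X) {..<length vs}"

definition grad :: "'a list \<Rightarrow> ('a \<times> 'a) list \<Rightarrow> real mat" where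
  "grad vs es = Matrix.mat (length es) (length vs)
     (\<lambda>(k, c). of_bool (vs ! c = fst (es ! k)) - of_bool (vs ! c = snd (es ! k)))"

definition laplacian :: "'a list \<Rightarrow> ('a \<times> 'a) list \<Rightarrow> real Matrix.vec \<Rightarrow> real mat" where
  "laplacian vs es s =
     transpose_mat (grad vs es) * mat_diag (length es) (\<lambda>k. s $ k) * grad vs es"

text \<open>
  \<open>mat_inverse\<close> returns an option; for a connected graph with nonempty \<open>B\<close> the submatrix is
  invertible, so that \<open>the\<close> is applied to a \<open>Some\<close> value.
\<close>

definition green :: "'a list \<Rightarrow> ('a \<times> 'a) list \<Rightarrow> real Matrix.vec \<Rightarrow> 'a set \<Rightarrow> real mat" where
  "green vs es \<sigma> B =
     (let X = set vs - B; I = vertex_indices vs X in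
      transpose_mat (restr vs X) * the (mat_inverse (submatrix (laplacian vs es \<sigma>) I I)) * restr vs X)"

definition cmult_vec :: "real Matrix.vec \<Rightarrow> real Matrix.vec \<Rightarrow> real Matrix.vec" where
  "cmult_vec p s = Matrix.vec (dim_vec s) (\<lambda>k. p $ k * s $ k)"

definition gamma0 :: "'a list \<Rightarrow> 'a set \<Rightarrow> real mat" where
  "gamma0 vs bd = restr vs bd"

definition gamma1_plus ::
  "'a list \<Rightarrow> ('a \<times> 'a) list \<Rightarrow> real Matrix.vec \<Rightarrow> 'a set \<Rightarrow> real Matrix.vec \<Rightarrow> real mat" where
  "gamma1_plus vs es \<sigma> bd pp = - (restr vs bd * laplacian vs es (cmult_vec pp \<sigma>))"

definition gamma1_minus ::
  "'a list \<Rightarrow> ('a \<times> 'a) list \<Rightarrow> real Matrix.vec \<Rightarrow> 'a set \<Rightarrow> real Matrix.vec \<Rightarrow> real mat" where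
  "gamma1_minus vs es \<sigma> bd pm = restr vs bd * laplacian vs es (cmult_vec pm \<sigma>)"

definition single_layer ::
  "'a list \<Rightarrow> ('a \<times> 'a) list \<Rightarrow> real Matrix.vec \<Rightarrow> 'a set \<Rightarrow> 'a set \<Rightarrow> real mat" where
  "single_layer vs es \<sigma> B bd = green vs es \<sigma> B * transpose_mat (gamma0 vs bd)"

definition neumann_poincare ::
  "'a list \<Rightarrow> ('a \<times> 'a) list \<Rightarrow> real Matrix.vec \<Rightarrow> 'a set \<Rightarrow> 'a set \<Rightarrow>
   real Matrix.vec \<Rightarrow> real Matrix.vec \<Rightarrow> real mat" where
  "neumann_poincare vs es \<sigma> B bd pp pm =
     (1 / 2) \<cdot>\<^sub>m ((gamma1_plus vs es \<sigma> bd pp + gamma1_minus vs es \<sigma> bd pm) * single_layer vs es \<sigma> B bd)"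

end

theory Submission
  imports Defs
begin

text \<open>
  Write \<open>Q\<close> for the restriction to \<open>\<partial>\<Omega>\<close>, \<open>K = G Q\<^sup>T\<close> for the single layer operator,
  \<open>H = \<nabla> K\<close>, and \<open>\<tau> = (\<sigma>\<^sup>- - \<sigma>\<^sup>+) / 2\<close>, so that \<open>D' = Q L(\<tau>) K\<close>.  Every column of \<open>K\<close>
  vanishes on \<open>B\<close> and is harmonic on \<open>\<Omega>\<^sup>+\<close> and \<open>\<Omega>\<^sup>-\<close>, where the rows of \<open>L(\<tau>)\<close> are \<open>-1/2\<close> and
  \<open>1/2\<close> times those of \<open>L(\<sigma>)\<close>.  Hence \<open>K\<^sup>T L(\<tau>) K = K\<^sup>T Q\<^sup>T D' = K\<^sup>T L(\<sigma>) K D'\<close>, that is,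
  \<open>H\<^sup>T diag(\<tau>) H = H\<^sup>T diag(\<sigma>) H D'\<close>.  An eigenvalue of \<open>D'\<close> with eigenvector \<open>v\<close> is therefore
  the quotient of the real numbers \<open>\<Sum>\<^sub>k \<tau>\<^sub>k |(H v)\<^sub>k|\<^sup>2\<close> and \<open>\<Sum>\<^sub>k \<sigma>\<^sub>k |(H v)\<^sub>k|\<^sup>2\<close>, the second of which
  is positive because \<open>H\<close> is injective: \<open>\<nabla>\<^sup>T diag(\<sigma>) H v = L(\<sigma>) K v\<close> agrees with \<open>Q\<^sup>T v\<close> off \<open>B\<close>.
\<close>

section \<open>Matrix products, diagonal matrices and conjugation\<close>

text \<open>Equations between dimensions replace the carrier conditions of
  \<open>assoc_mult_mat\<close>, so that the simplifier can discharge them and use associativity as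
  a rewrite rule.\<close>

lemma mult_mat_assoc:
  fixes A B C :: "'b :: semiring_0 mat"
  assumes "dim_col A = dim_row B" "dim_col B = dim_row C"
  shows "A * B * C = A * (B * C)"
  by (rule assoc_mult_mat[of _ "dim_row A" "dim_col A" _ "dim_col B" _ "dim_col C"])
    (use assms in auto)

lemma mult_mat_vec_assoc:
  fixes A B :: "'b :: semiring_0 mat"
  assumes "dim_col A = dim_row B" "dim_col B = dim_vec v"
  shows "(A * B) *\<^sub>v v = A *\<^sub>v (B *\<^sub>v v)"
  by (rule assoc_mult_mat_vec[of _ "dim_row A" "dim_col A" _ "dim_col B"])
    (use assms in auto)

lemma dim_mat_diag [simp]: "dim_row (mat_diag n f) = n" "dim_col (mat_diag n f) = n"
  by (simp_all add: mat_diag_def)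

lemma mat_diag_mult_vec:
  fixes f :: "nat \<Rightarrow> 'b :: semiring_0"
  assumes "v \<in> carrier_vec n"
  shows "mat_diag n f *\<^sub>v v = Matrix.vec n (\<lambda>k. f k * v $ k)"
proof (rule eq_vecI)
  fix i assume "i < dim_vec (Matrix.vec n (\<lambda>k. f k * v $ k))"
  then have i: "i < n" by simp
  have "(mat_diag n f *\<^sub>v v) $ i = (\<Sum>k\<in>{0..<n}. (if i = k then f k else 0) * v $ k)"
    using i assms by (simp add: mat_diag_def scalar_prod_def)
  also have "\<dots> = (\<Sum>k\<in>{0..<n}. if i = k then f k * v $ k else 0)"
    by (rule sum.cong) auto
  finally show "(mat_diag n f *\<^sub>v v) $ i = Matrix.vec n (\<lambda>k. f k * v $ k) $ i"
    using i by simp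
qed (simp add: mat_diag_def)

lemma map_mat_diag:
  "f 0 = 0 \<Longrightarrow> map_mat f (mat_diag n d) = mat_diag n (\<lambda>k. f (d k))"
  by (rule eq_matI) (auto simp: mat_diag_def)

lemma conjugate_mult_mat_vec_of_real:
  assumes "A \<in> carrier_mat m n" "v \<in> carrier_vec n"
  shows "conjugate (map_mat complex_of_real A *\<^sub>v v) = map_mat complex_of_real A *\<^sub>v conjugate v"
proof (rule eq_vecI)
  fix i assume "i < dim_vec (map_mat complex_of_real A *\<^sub>v conjugate v)"
  then have i: "i < m" using assms(1) by simp
  have "conjugate (map_mat complex_of_real A *\<^sub>v v) $ i
      = cnj (\<Sum>k\<in>{0..<n}. complex_of_real (A $$ (i, k)) * v $ k)"
    using i assms by (simp add: scalar_prod_def)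
  also have "\<dots> = (map_mat complex_of_real A *\<^sub>v conjugate v) $ i"
    unfolding cnj_sum using i assms by (simp add: scalar_prod_def)
  finally show "conjugate (map_mat complex_of_real A *\<^sub>v v) $ i
      = (map_mat complex_of_real A *\<^sub>v conjugate v) $ i" .
qed (use assms in simp)

section \<open>Real eigenvalues from a relation between two quadratic forms\<close>

text \<open>Moving the transpose of \<open>H\<close> to the other factor leaves \<open>H\<close>
  applied to \<open>conjugate v\<close>. This is \<open>conjugate h\<close> because \<open>H\<close>
  is real, so each entry of \<open>h\<close> meets its own conjugate.\<close>

lemma congruence_form:
  fixes H :: "real mat" and v :: "complex Matrix.vec"
  assumes H: "H \<in> carrier_mat m q" and v: "v \<in> carrier_vec q"
  defines "h \<equiv> map_mat complex_of_real H *\<^sub>v v"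
  shows "(map_mat complex_of_real (transpose_mat H * mat_diag m d * H) *\<^sub>v v) \<bullet> conjugate v
    = complex_of_real (\<Sum>k<m. d k * (cmod (h $ k))\<^sup>2)"
proof -
  let ?c = "map_mat complex_of_real"
  have h: "h \<in> carrier_vec m" unfolding h_def using H v by auto
  have cH: "?c H \<in> carrier_mat m q" using H by auto
  have "?c (transpose_mat H * mat_diag m d * H)
      = transpose_mat (?c H) * mat_diag m (\<lambda>k. complex_of_real (d k)) * ?c H"
    using H by (simp add: of_real_hom.mat_hom_mult[of _ q m _ q] of_real_hom.mat_hom_mult[of _ q m _ m]
        map_mat_transpose map_mat_diag)
  then have "?c (transpose_mat H * mat_diag m d * H) *\<^sub>v v
      = transpose_mat (?c H) *\<^sub>v (Matrix.vec m (\<lambda>k. complex_of_real (d k) * h $ k))"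
    using H v h by (simp add: mult_mat_vec_assoc mat_diag_mult_vec h_def[symmetric])
  then have "(?c (transpose_mat H * mat_diag m d * H) *\<^sub>v v) \<bullet> conjugate v
      = Matrix.vec m (\<lambda>k. complex_of_real (d k) * h $ k) \<bullet> (?c H *\<^sub>v conjugate v)"
    using transpose_vec_mult_scalar[OF cH, of "conjugate v"] v by simp
  also have "?c H *\<^sub>v conjugate v = conjugate h"
    unfolding h_def using conjugate_mult_mat_vec_of_real[OF H v] by simp
  also have "Matrix.vec m (\<lambda>k. complex_of_real (d k) * h $ k) \<bullet> conjugate h
      = (\<Sum>k<m. complex_of_real (d k * (cmod (h $ k))\<^sup>2))"
    using h by (auto simp: scalar_prod_def lessThan_atLeast0 complex_norm_square mult.assoc simp del: of_real_power
        intro!: sum.cong)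
  finally show ?thesis by simp
qed

text \<open>For an eigenvector \<open>v\<close> of \<open>T\<close> with eigenvalue
  \<open>\<mu>\<close>, applying both sides of \<open>eq\<close> to \<open>v\<close> and pairing
  with \<open>conjugate v\<close> gives \<open>N t = \<mu> * N s\<close>. Positive weights and the
  left inverse \<open>W\<close> of \<open>H\<close> make \<open>N s\<close> nonzero.\<close>

lemma spectrum_real_of_congruence:
  fixes H T W :: "real mat"
  assumes H: "H \<in> carrier_mat m q" and T: "T \<in> carrier_mat q q" and W: "W \<in> carrier_mat q m"
    and WH: "W * H = 1\<^sub>m q" and pos: "\<And>k. k < m \<Longrightarrow> s k > 0"
    and eq: "transpose_mat H * mat_diag m t * H = transpose_mat H * mat_diag m s * H * T"
  shows "spectrum (map_mat complex_of_real T) \<subseteq> \<real>"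
proof
  let ?c = "map_mat complex_of_real"
  fix \<mu> assume "\<mu> \<in> spectrum (?c T)"
  then obtain v where v: "v \<in> carrier_vec q" "v \<noteq> 0\<^sub>v q" "?c T *\<^sub>v v = \<mu> \<cdot>\<^sub>v v"
    using T by (auto simp: spectrum_def eigenvalue_def eigenvector_def)
  define h where "h = ?c H *\<^sub>v v"
  define S where "S = transpose_mat H * mat_diag m s * H"
  define N where "N d = (\<Sum>k<m. d k * (cmod (h $ k))\<^sup>2)" for d :: "nat \<Rightarrow> real"
  have h: "h \<in> carrier_vec m" unfolding h_def using H v by auto
  have S: "S \<in> carrier_mat q q" unfolding S_def using H by auto
  have "h \<noteq> 0\<^sub>v m"
  proof
    assume "h = 0\<^sub>v m"
    then have "?c W *\<^sub>v h = 0\<^sub>v q" using W by (auto simp: scalar_prod_def)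
    moreover have "?c W *\<^sub>v h = ?c (W * H) *\<^sub>v v"
      unfolding h_def using W H v by (simp add: of_real_hom.mat_hom_mult mult_mat_vec_assoc)
    ultimately show False using v WH by (simp add: of_real_hom.mat_hom_one)
  qed
  then obtain k where k: "k < m" "h $ k \<noteq> 0" using h by (metis eq_vecI carrier_vecD index_zero_vec)
  have "N s > 0"
    unfolding N_def using k pos by (intro sum_pos2[of _ k]) (auto simp: less_imp_le)
  have "?c (S * T) *\<^sub>v v = ?c S *\<^sub>v (\<mu> \<cdot>\<^sub>v v)"
    using S T v by (simp add: of_real_hom.mat_hom_mult mult_mat_vec_assoc)
  also have "\<dots> = \<mu> \<cdot>\<^sub>v (?c S *\<^sub>v v)"
    using S v by (simp add: mult_mat_vec[of _ q q])
  finally have "(?c (S * T) *\<^sub>v v) \<bullet> conjugate v = \<mu> * ((?c S *\<^sub>v v) \<bullet> conjugate v)"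
    using S v by (simp add: smult_scalar_prod_distrib[of _ q])
  moreover have "(?c (S * T) *\<^sub>v v) \<bullet> conjugate v = complex_of_real (N t)"
    using congruence_form[OF H v(1), of t] eq by (simp add: S_def N_def h_def)
  moreover have "(?c S *\<^sub>v v) \<bullet> conjugate v = complex_of_real (N s)"
    using congruence_form[OF H v(1), of s] by (simp add: S_def N_def h_def)
  ultimately have "\<mu> = complex_of_real (N t / N s)"
    using \<open>N s > 0\<close> by (simp add: field_simps)
  then show "\<mu> \<in> \<real>" by simp
qed

section \<open>Restriction matrices as selections of rows and columns\<close>

lemma pick_lessThan:
  assumes "j < n"
  shows "pick {..<n} j = j"
proof -
  have "{a \<in> {..<n}. a < j} = {..<j}" using assms by auto
  then show ?thesis using pick_card_in_set[of j "{..<n}"] assms by simp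
qed

lemma vertex_indices_subset: "vertex_indices vs X \<subseteq> {..<length vs}"
  by (auto simp: vertex_indices_def)

lemma finite_vertex_indices [simp]: "finite (vertex_indices vs X)"
  using vertex_indices_subset finite_subset by blast

lemma pick_vertex_indices:
  assumes "i < card (vertex_indices vs X)"
  shows "pick (vertex_indices vs X) i < length vs" "vs ! pick (vertex_indices vs X) i \<in> X"
  using pick_in_set_le[OF assms] by (auto simp: vertex_indices_def)

lemma vertex_indicesE:
  assumes "j < length vs" "vs ! j \<in> X"
  obtains i where "i < card (vertex_indices vs X)" "pick (vertex_indices vs X) i = j"
proof
  let ?I = "vertex_indices vs X"
  have "j \<in> ?I" using assms by (simp add: vertex_indices_def)
  \<comment> \<open>\<open>pick\<close> lists the set in increasing order, so the position of
    \<open>j\<close> is the number of smaller indices in it.\<close>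
  then show "pick ?I (card {a \<in> ?I. a < j}) = j" by (rule pick_card_in_set)
  show "card {a \<in> ?I. a < j} < card ?I"
    using \<open>j \<in> ?I\<close> by (intro psubset_card_mono) auto
qed

lemma pick_vertex_indices_eq_iff:
  assumes "i < card (vertex_indices vs X)" "j < card (vertex_indices vs X)"
  shows "pick (vertex_indices vs X) i = pick (vertex_indices vs X) j \<longleftrightarrow> i = j"
  using card_pick_le[OF assms(1)] card_pick_le[OF assms(2)] by metis

text \<open>The left-hand side is the form in which the facts on \<open>submatrix\<close> count rows
  and columns.\<close>

lemma card_vertex_indices_filter:
  "card {i. i < length vs \<and> i \<in> vertex_indices vs X} = card (vertex_indices vs X)"
  by (rule arg_cong[of _ _ card]) (auto simp: vertex_indices_def)

lemma dim_restr [simp]: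
  "dim_row (restr vs X) = card (vertex_indices vs X)" "dim_col (restr vs X) = length vs"
proof -
  have "{j. j < length vs} = {..<length vs}" by auto
  then show "dim_row (restr vs X) = card (vertex_indices vs X)" "dim_col (restr vs X) = length vs"
    by (simp_all add: restr_def dim_submatrix card_vertex_indices_filter)
qed

lemma restr_index:
  assumes "i < card (vertex_indices vs X)" "j < length vs"
  shows "restr vs X $$ (i, j) = of_bool (pick (vertex_indices vs X) i = j)"
proof -
  have "{j. j < length vs} = {..<length vs}" by auto
  then show ?thesis
    using assms pick_vertex_indices[OF assms(1)] unfolding restr_def
    by (subst submatrix_index) (auto simp: card_vertex_indices_filter pick_lessThan)
qed

lemma restr_mult_index:
  assumes "i < card (vertex_indices vs X)" "j < dim_col A" "dim_row A = length vs"
  shows "(restr vs X * A) $$ (i, j) = A $$ (pick (vertex_indices vs X) i, j)"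
proof -
  have "(restr vs X * A) $$ (i, j)
      = (\<Sum>k\<in>{0..<length vs}. if pick (vertex_indices vs X) i = k then A $$ (k, j) else 0)"
    using assms by (auto simp: scalar_prod_def restr_index intro!: sum.cong)
  also have "\<dots> = A $$ (pick (vertex_indices vs X) i, j)"
    using pick_vertex_indices(1)[OF assms(1)] by (subst sum.delta') auto
  finally show ?thesis .
qed

text \<open>Transposition reduces this selection of columns to the selection of rows in
  \<open>restr_mult_index\<close>.\<close>

lemma mult_restr_transpose_index:
  assumes "i < dim_row A" "j < card (vertex_indices vs X)" "dim_col A = length vs"
  shows "(A * transpose_mat (restr vs X)) $$ (i, j) = A $$ (i, pick (vertex_indices vs X) j)"
proof -
  have "transpose_mat (restr vs X * transpose_mat A)
      = transpose_mat (transpose_mat A) * transpose_mat (restr vs X)"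
    by (rule transpose_mult[of _ "card (vertex_indices vs X)" "length vs" _ "dim_row A"])
      (use assms in auto)
  then have "(A * transpose_mat (restr vs X)) $$ (i, j)
      = transpose_mat (restr vs X * transpose_mat A) $$ (i, j)" by simp
  also have "\<dots> = (restr vs X * transpose_mat A) $$ (j, i)"
    using assms by (intro index_transpose_mat(1)) simp_all
  also have "\<dots> = transpose_mat A $$ (pick (vertex_indices vs X) j, i)"
    using assms by (intro restr_mult_index) simp_all
  also have "\<dots> = A $$ (i, pick (vertex_indices vs X) j)"
    using assms pick_vertex_indices(1)[OF assms(2)] by (intro index_transpose_mat(1)) simp_all
  finally show ?thesis .
qed

lemma restr_mult_restr_transpose:
  "restr vs X * transpose_mat (restr vs X) = 1\<^sub>m (card (vertex_indices vs X))"
proof (rule eq_matI)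
  fix i j
  assume "i < dim_row (1\<^sub>m (card (vertex_indices vs X)) :: real mat)"
    "j < dim_col (1\<^sub>m (card (vertex_indices vs X)) :: real mat)"
  then have ij: "i < card (vertex_indices vs X)" "j < card (vertex_indices vs X)" by simp_all
  have "(restr vs X * transpose_mat (restr vs X)) $$ (i, j)
      = restr vs X $$ (i, pick (vertex_indices vs X) j)"
    using ij by (intro mult_restr_transpose_index) simp_all
  also have "\<dots> = of_bool (i = j)"
    using ij pick_vertex_indices(1)[OF ij(2)] by (auto simp: restr_index pick_vertex_indices_eq_iff)
  finally show "(restr vs X * transpose_mat (restr vs X)) $$ (i, j)
      = 1\<^sub>m (card (vertex_indices vs X)) $$ (i, j)"
    using ij by simp
qed simp_all

text \<open>Turns the submatrix inside \<open>green\<close> into a product, so that the Green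
  function can be treated by matrix algebra alone.\<close>

lemma submatrix_eq_restr:
  fixes vs :: "'a list" and X :: "'a set"
  assumes "A \<in> carrier_mat (length vs) (length vs)"
  defines "I \<equiv> vertex_indices vs X"
  shows "submatrix A I I = restr vs X * A * transpose_mat (restr vs X)"
proof (rule eq_matI)
  have dim: "dim_row A = length vs" "dim_col A = length vs" using assms by auto
  then show dim_sub: "dim_row (submatrix A I I) = dim_row (restr vs X * A * transpose_mat (restr vs X))"
    "dim_col (submatrix A I I) = dim_col (restr vs X * A * transpose_mat (restr vs X))"
    by (simp_all add: dim_submatrix I_def card_vertex_indices_filter)
  fix i j
  assume "i < dim_row (restr vs X * A * transpose_mat (restr vs X))"
    "j < dim_col (restr vs X * A * transpose_mat (restr vs X))"
  then have ij: "i < card I" "j < card I" by (simp_all add: I_def)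
  have "submatrix A I I $$ (i, j) = A $$ (pick I i, pick I j)"
    using ij by (intro submatrix_index) (simp_all add: dim I_def card_vertex_indices_filter)
  also have "\<dots> = (restr vs X * A * transpose_mat (restr vs X)) $$ (i, j)"
    using ij dim pick_vertex_indices(1)[of j vs X] unfolding I_def
    by (subst mult_restr_transpose_index) (simp_all add: restr_mult_index del: index_mult_mat(1))
  finally show "submatrix A I I $$ (i, j) = (restr vs X * A * transpose_mat (restr vs X)) $$ (i, j)" .
qed

text \<open>This is the orthogonal projection onto the vectors supported on \<open>X\<close>: entry
  \<open>(i, j)\<close> counts the \<open>k\<close> that \<open>pick\<close> sends to both
  \<open>i\<close> and \<open>j\<close>.\<close>

lemma restr_proj:
  "transpose_mat (restr vs X) * restr vs X
    = mat_diag (length vs) (\<lambda>j. of_bool (vs ! j \<in> X))" (is "?P = _")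
proof (rule eq_matI)
  let ?I = "vertex_indices vs X"
  fix i j assume "i < dim_row (mat_diag (length vs) (\<lambda>j. of_bool (vs ! j \<in> X) :: real))"
    "j < dim_col (mat_diag (length vs) (\<lambda>j. of_bool (vs ! j \<in> X) :: real))"
  then have ij: "i < length vs" "j < length vs" by auto
  have e: "?P $$ (i, j) = (\<Sum>k\<in>{0..<card ?I}. of_bool (pick ?I k = i) * of_bool (pick ?I k = j))"
    using ij by (auto simp: scalar_prod_def restr_index intro!: sum.cong)
  show "?P $$ (i, j) = mat_diag (length vs) (\<lambda>j. of_bool (vs ! j \<in> X)) $$ (i, j)"
  proof (cases "i = j \<and> vs ! i \<in> X")
    case True
    then obtain k0 where k0: "k0 < card ?I" "pick ?I k0 = i" using vertex_indicesE ij by metis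
    have "?P $$ (i, j) = (\<Sum>k\<in>{0..<card ?I}. if k = k0 then 1 else 0)"
      unfolding e using True k0 by (intro sum.cong) (auto simp: pick_vertex_indices_eq_iff)
    then have "?P $$ (i, j) = 1" using k0 by simp
    then show ?thesis using True ij by (auto simp: mat_diag_def simp del: index_mult_mat(1))
  next
    case False
    have "?P $$ (i, j) = 0"
      unfolding e using False by (intro sum.neutral) (auto dest: pick_vertex_indices)
    then show ?thesis using False ij by (auto simp: mat_diag_def simp del: index_mult_mat(1))
  qed
qed auto

text \<open>The rows of \<open>restr vs X\<close> are unit vectors at vertices of \<open>Y\<close>,
  and the projection onto \<open>Y\<close> fixes these.\<close>

lemma restr_subset:
  assumes "X \<subseteq> Y"
  shows "restr vs X * (transpose_mat (restr vs Y) * restr vs Y) = restr vs X"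
proof (rule eq_matI)
  fix i j assume "i < dim_row (restr vs X)" "j < dim_col (restr vs X)"
  then have ij: "i < card (vertex_indices vs X)" "j < length vs" by simp_all
  let ?p = "pick (vertex_indices vs X) i"
  have p: "?p < length vs" "vs ! ?p \<in> Y"
    using pick_vertex_indices[OF ij(1)] assms by auto
  have "(restr vs X * (transpose_mat (restr vs Y) * restr vs Y)) $$ (i, j)
      = (transpose_mat (restr vs Y) * restr vs Y) $$ (?p, j)"
    using ij by (intro restr_mult_index) simp_all
  also have "\<dots> = restr vs X $$ (i, j)"
    unfolding restr_proj using ij p by (auto simp: mat_diag_def restr_index)
  finally show "(restr vs X * (transpose_mat (restr vs Y) * restr vs Y)) $$ (i, j)
      = restr vs X $$ (i, j)" .
qed simp_all

section \<open>Gradient, Laplacian and Dirichlet energy\<close>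

lemma dim_grad [simp]: "dim_row (grad vs es) = length es" "dim_col (grad vs es) = length vs"
  by (simp_all add: grad_def)

lemma dim_laplacian [simp]:
  "dim_row (laplacian vs es s) = length vs" "dim_col (laplacian vs es s) = length vs"
  by (simp_all add: laplacian_def)

lemma laplacian_index:
  assumes "i < length vs" "j < length vs"
  shows "laplacian vs es s $$ (i, j)
    = (\<Sum>k<length es. s $ k * (grad vs es $$ (k, i) * grad vs es $$ (k, j)))"
proof -
  have "transpose_mat (grad vs es) * mat_diag (length es) (\<lambda>k. s $ k)
    = Matrix.mat (length vs) (length es) (\<lambda>(i,k). grad vs es $$ (k,i) * s $ k)"
    by (subst mat_diag_mult_right[of _ "length vs"]) auto
  then show ?thesis
    using assms
    by (auto simp: laplacian_def scalar_prod_def lessThan_atLeast0 mult_ac intro!: sum.cong)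
qed

text \<open>Column \<open>i\<close> of the gradient vanishes on every edge that does not meet
  \<open>vs ! i\<close>, so row \<open>i\<close> of the Laplacian sees only the conductivities of
  the incident edges.\<close>

lemma laplacian_row_eq:
  assumes "i < length vs" "j < length vs"
    and "\<And>k. k < length es \<Longrightarrow> fst (es ! k) = vs ! i \<or> snd (es ! k) = vs ! i \<Longrightarrow> t $ k = c * s $ k"
  shows "laplacian vs es t $$ (i, j) = c * laplacian vs es s $$ (i, j)"
  unfolding laplacian_index[OF assms(1,2)] sum_distrib_left
proof (rule sum.cong)
  fix k assume k: "k \<in> {..<length es}"
  show "t $ k * (grad vs es $$ (k, i) * grad vs es $$ (k, j))
      = c * (s $ k * (grad vs es $$ (k, i) * grad vs es $$ (k, j)))"
    using assms(1) assms(3)[of k] k by (auto simp: grad_def)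
qed simp

lemma grad_mult_vec:
  assumes "distinct vs" "fst (es ! k) = vs ! a" "snd (es ! k) = vs ! b"
    and "a < length vs" "b < length vs" "k < length es" "u \<in> carrier_vec (length vs)"
  shows "(grad vs es *\<^sub>v u) $ k = u $ a - u $ b"
proof -
  have "(grad vs es *\<^sub>v u) $ k
      = (\<Sum>c\<in>{0..<length vs}. (if c = a then u $ c else 0) - (if c = b then u $ c else 0))"
    using assms by (auto simp: scalar_prod_def grad_def nth_eq_iff_index_eq intro!: sum.cong)
  then show ?thesis using assms by (simp add: sum_subtractf)
qed

text \<open>Any two vertices are linked by a path in the symmetric closure, each step of which is an
  arc or a reversed arc; induction along the path carries the value of \<open>f\<close>.\<close>

lemma connected_constant:
  assumes conn: "Digraph_Component.connected (with_proj G)"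
    and const: "\<And>x y. (x, y) \<in> parcs G \<Longrightarrow> f x = f y"
    and "u \<in> pverts G" "v \<in> pverts G"
  shows "f u = f v"
proof -
  have "u \<rightarrow>\<^sup>*\<^bsub>with_proj (mk_symmetric (with_proj G))\<^esub> v"
    using conn assms(3,4) by (auto simp: connected_def strongly_connected_def)
  then have "(u, v) \<in> rtrancl_on (pverts G) (parcs (mk_symmetric (with_proj G)))"
    by (simp add: reachable_def)
  then show ?thesis
    by induct (use const in \<open>fastforce simp: parcs_mk_symmetric\<close>)+
qed

text \<open>A vanishing gradient makes \<open>u\<close> constant on a connected graph, and the
  constant is read off at \<open>b\<close>.\<close>

lemma grad_kernel_zero:
  assumes G: "pair_graph G" "Digraph_Component.connected (with_proj G)"
    and vs: "vertex_enum G vs" and es: "edge_enum G es"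
    and u: "u \<in> carrier_vec (length vs)" and gu: "grad vs es *\<^sub>v u = 0\<^sub>v (length es)"
    and b: "b < length vs" "u $ b = 0"
  shows "u = 0\<^sub>v (length vs)"
proof
  interpret pair_graph G by fact
  have d: "distinct vs" and sv: "set vs = pverts G" using vs by (auto simp: vertex_enum_def)
  \<comment> \<open>\<open>f\<close> carries \<open>u\<close> from indices to vertices; the
    description is unique on vertices because \<open>vs\<close> is distinct.\<close>
  define f where "f = (\<lambda>x. u $ (THE i. i < length vs \<and> vs ! i = x))"
  have f: "f (vs ! i) = u $ i" if "i < length vs" for i
    unfolding f_def using d that by (auto intro!: arg_cong[where f = "($) u"] the_equality simp: nth_eq_iff_index_eq)
  have "f x = f y" if xy: "(x, y) \<in> set es" for x y
  proof -
    obtain k where k: "k < length es" "es ! k = (x, y)" using xy by (auto simp: in_set_conv_nth)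
    have "(x, y) \<in> parcs G" using es xy by (auto simp: edge_enum_def)
    then have "x \<in> set vs" "y \<in> set vs" using wellformed' sv by auto
    then obtain i j where ij: "i < length vs" "vs ! i = x" "j < length vs" "vs ! j = y"
      by (auto simp: in_set_conv_nth)
    have "(grad vs es *\<^sub>v u) $ k = u $ i - u $ j"
      using grad_mult_vec[OF d, of es k i j u] ij k u by simp
    then show ?thesis using gu f ij k by auto
  qed
  \<comment> \<open>Only one orientation of each edge is in \<open>es\<close>; the other follows by
    symmetry of equality.\<close>
  moreover have "(x, y) \<in> set es \<or> (y, x) \<in> set es" if "(x, y) \<in> parcs G" for x y
    using es that by (auto simp: edge_enum_def)
  ultimately have "f x = f y" if "(x, y) \<in> parcs G" for x y
    using that by metis
  then have const: "f (vs ! i) = f (vs ! b)" if "i < length vs" for i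
    using connected_constant[OF G(2), of f] that b sv nth_mem by metis
  show "u $ i = 0\<^sub>v (length vs) $ i" if "i < dim_vec (0\<^sub>v (length vs) :: real Matrix.vec)" for i
    using const[of i] f that b by auto
qed (use u in auto)

text \<open>Moving the transposed gradient to the other factor exhibits the quadratic form as the
  Dirichlet energy.\<close>

lemma laplacian_form:
  assumes "u \<in> carrier_vec (length vs)"
  shows "u \<bullet> (laplacian vs es s *\<^sub>v u) = (\<Sum>k<length es. s $ k * ((grad vs es *\<^sub>v u) $ k)\<^sup>2)"
proof -
  let ?g = "grad vs es"
  have g: "?g \<in> carrier_mat (length es) (length vs)" by auto
  have gu: "?g *\<^sub>v u \<in> carrier_vec (length es)" by (rule carrier_vecI) simp
  have "laplacian vs es s *\<^sub>v u
      = transpose_mat ?g *\<^sub>v Matrix.vec (length es) (\<lambda>k. s $ k * (?g *\<^sub>v u) $ k)"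
    using assms gu by (simp add: laplacian_def mult_mat_vec_assoc mat_diag_mult_vec)
  then have "(laplacian vs es s *\<^sub>v u) \<bullet> u
      = Matrix.vec (length es) (\<lambda>k. s $ k * (?g *\<^sub>v u) $ k) \<bullet> (?g *\<^sub>v u)"
    using transpose_vec_mult_scalar[OF g assms] by simp
  moreover have "u \<bullet> (laplacian vs es s *\<^sub>v u) = (laplacian vs es s *\<^sub>v u) \<bullet> u"
    using assms by (intro comm_scalar_prod[of _ "length vs"] carrier_vecI) auto
  ultimately show ?thesis
    by (auto simp: scalar_prod_def lessThan_atLeast0 power2_eq_square mult.assoc intro!: sum.cong)
qed

section \<open>Invertibility off \<open>B\<close>, the Green function and the single layer
  operator\<close>

lemma mat_inverse_Some:
  fixes A :: "'b :: field mat"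
  assumes A: "A \<in> carrier_mat n n"
    and ker: "\<And>x. x \<in> carrier_vec n \<Longrightarrow> A *\<^sub>v x = 0\<^sub>v n \<Longrightarrow> x = 0\<^sub>v n"
  obtains C where "mat_inverse A = Some C" "C \<in> carrier_mat n n" "A * C = 1\<^sub>m n" "C * A = 1\<^sub>m n"
proof -
  have "det A \<noteq> 0" using det_0_iff_vec_prod_zero_field[OF A] ker by blast
  \<comment> \<open>The slot \<open>b\<close> of the matrix ring is set to \<open>()\<close> in both
    facts so that they speak of the same ring.\<close>
  then have "mat_inverse A \<noteq> None"
    using mat_inverse(1)[OF A, where b = "()"] det_non_zero_imp_unit[OF A, where b = "()"] by blast
  then show thesis using mat_inverse(2)[OF A] that by auto
qed

text \<open>A kernel vector of the interior Laplacian, extended by zero to \<open>B\<close>, has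
  zero energy and hence zero gradient. As it vanishes at a vertex of \<open>B\<close>, connectedness
  makes it zero.\<close>

lemma laplacian_interior_inverse:
  assumes G: "pair_graph G" "Digraph_Component.connected (with_proj G)"
    and vs: "vertex_enum G vs" and es: "edge_enum G es"
    and B: "B \<inter> pverts G \<noteq> {}"
    and pos: "\<And>k. k < length es \<Longrightarrow> s $ k > 0"
  defines "R \<equiv> restr vs (set vs - B)"
  obtains C where "C \<in> carrier_mat (dim_row R) (dim_row R)"
    "R * laplacian vs es s * transpose_mat R * C = 1\<^sub>m (dim_row R)"
    "green vs es s B = transpose_mat R * C * R"
proof -
  define A where "A = R * laplacian vs es s * transpose_mat R"
  have L: "laplacian vs es s \<in> carrier_mat (length vs) (length vs)" by auto
  have R: "R \<in> carrier_mat (dim_row R) (length vs)" by (auto simp: R_def)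
  have A: "A \<in> carrier_mat (dim_row R) (dim_row R)" by (auto simp: A_def)
  obtain b where b: "b < length vs" "vs ! b \<in> B"
  proof -
    obtain x where "x \<in> B" "x \<in> set vs" using B vs by (auto simp: vertex_enum_def)
    then show thesis using that by (auto simp: in_set_conv_nth)
  qed
  have "x = 0\<^sub>v (dim_row R)" if x: "x \<in> carrier_vec (dim_row R)" and Ax: "A *\<^sub>v x = 0\<^sub>v (dim_row R)" for x
  proof -
    \<comment> \<open>The extension of \<open>x\<close> by zero to \<open>B\<close>.\<close>
    define u where "u = transpose_mat R *\<^sub>v x"
    have u: "u \<in> carrier_vec (length vs)" by (rule carrier_vecI) (simp add: u_def R_def)
    have Rb: "R $$ (i, b) = 0" if "i < dim_row R" for i
    proof -
      have i: "i < card (vertex_indices vs (set vs - B))" using that by (simp add: R_def)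
      show ?thesis
        unfolding R_def restr_index[OF i b(1)] using pick_vertex_indices(2)[OF i] b(2) by auto
    qed
    have ub: "u $ b = 0"
    proof -
      have "u $ b = (\<Sum>i\<in>{0..<dim_row R}. R $$ (i, b) * x $ i)"
        using b(1) carrier_vecD[OF x] by (simp add: u_def scalar_prod_def R_def)
      then show ?thesis using Rb by simp
    qed
    have "u \<bullet> (laplacian vs es s *\<^sub>v u) = x \<bullet> (R *\<^sub>v (laplacian vs es s *\<^sub>v u))"
      unfolding u_def by (rule transpose_vec_mult_scalar[OF R _ x]) (rule carrier_vecI, simp)
    also have "R *\<^sub>v (laplacian vs es s *\<^sub>v u) = A *\<^sub>v x"
      using carrier_vecD[OF x] by (simp add: A_def u_def R_def mult_mat_vec_assoc)
    also have "x \<bullet> (A *\<^sub>v x) = 0" using Ax x by simp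
    finally have "(\<Sum>k<length es. s $ k * ((grad vs es *\<^sub>v u) $ k)\<^sup>2) = 0"
      using laplacian_form[OF u] by simp
    then have "\<forall>k<length es. (grad vs es *\<^sub>v u) $ k = 0"
      using pos by (subst (asm) sum_nonneg_eq_0_iff) (force simp: less_imp_le)+
    then have "grad vs es *\<^sub>v u = 0\<^sub>v (length es)" by (intro eq_vecI) auto
    then have "u = 0\<^sub>v (length vs)" using grad_kernel_zero[OF G vs es u _ b(1) ub] by simp
    \<comment> \<open>Restricting the extension gives \<open>x\<close> back, since \<open>R\<close>
      times its transpose is the identity.\<close>
    moreover have "R *\<^sub>v u = x"
      using x carrier_vecD[OF x] mult_mat_vec_assoc[of R "transpose_mat R" x]
      by (simp add: u_def R_def restr_mult_restr_transpose)
    ultimately have "x = R *\<^sub>v 0\<^sub>v (length vs)" by simp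
    also have "\<dots> = 0\<^sub>v (dim_row R)"
      by (rule eq_vecI) (simp_all add: R_def scalar_prod_def)
    finally show ?thesis .
  qed
  then obtain C where C: "mat_inverse A = Some C" "C \<in> carrier_mat (dim_row R) (dim_row R)"
    "A * C = 1\<^sub>m (dim_row R)"
    using mat_inverse_Some[OF A] by blast
  have "green vs es s B = transpose_mat R * C * R"
    using C(1) submatrix_eq_restr[OF L, of "set vs - B"] by (simp add: green_def Let_def A_def R_def)
  then show thesis using that C(2) C(3)[unfolded A_def] by blast
qed

text \<open>\<open>P\<close> projects onto the functions that vanish on \<open>B\<close>. The Green
  function takes values in its range, and off \<open>B\<close> it is a right inverse of the
  Laplacian.\<close>

lemma laplacian_mult_single_layer:
  assumes G: "pair_graph G" "Digraph_Component.connected (with_proj G)"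
    and vs: "vertex_enum G vs" and es: "edge_enum G es"
    and B: "B \<inter> pverts G \<noteq> {}" and bd: "bd \<subseteq> set vs - B"
    and pos: "\<And>k. k < length es \<Longrightarrow> s $ k > 0"
  defines "P \<equiv> transpose_mat (restr vs (set vs - B)) * restr vs (set vs - B)"
    and "K \<equiv> single_layer vs es s B bd"
  shows "P * (laplacian vs es s * K) = transpose_mat (restr vs bd)" and "P * K = K"
    and "dim_row K = length vs"
proof -
  let ?R = "restr vs (set vs - B)" and ?Q = "restr vs bd"
  obtain C where C: "C \<in> carrier_mat (dim_row ?R) (dim_row ?R)"
    "?R * laplacian vs es s * transpose_mat ?R * C = 1\<^sub>m (dim_row ?R)"
    "green vs es s B = transpose_mat ?R * C * ?R"
    using laplacian_interior_inverse[OF G vs es B pos] by blast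
  have K: "K = transpose_mat ?R * (C * (?R * transpose_mat ?Q))"
    using C by (simp add: K_def single_layer_def gamma0_def mult_mat_assoc)
  show "dim_row K = length vs" by (simp add: K)
  have RR: "?R * (transpose_mat ?R * X) = X" if "dim_row X = dim_row ?R" for X
    using that mult_mat_assoc[of ?R "transpose_mat ?R" X]
    by (simp add: restr_mult_restr_transpose left_mult_one_mat')
  show "P * K = K" using C by (simp add: K P_def mult_mat_assoc RR)
  have "P * (laplacian vs es s * K)
      = transpose_mat ?R * ((?R * laplacian vs es s * transpose_mat ?R * C) * (?R * transpose_mat ?Q))"
    using C(1) by (simp add: K P_def mult_mat_assoc)
  also have "\<dots> = P * transpose_mat ?Q"
    unfolding C(2) by (simp add: P_def mult_mat_assoc left_mult_one_mat')
  also have "\<dots> = transpose_mat (?Q * P)"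
  proof -
    have "transpose_mat (?Q * P) = transpose_mat P * transpose_mat ?Q"
      by (rule transpose_mult[of _ "dim_row ?Q" "length vs" _ "length vs"]) (auto simp: P_def)
    moreover have "transpose_mat P = P"
      unfolding P_def restr_proj by (rule eq_matI) (auto simp: mat_diag_def)
    ultimately show ?thesis by simp
  qed
  \<comment> \<open>The set \<open>bd\<close> is disjoint from \<open>B\<close>, so projecting off
    \<open>B\<close> first does not change the restriction.\<close>
  also have "?Q * P = ?Q" unfolding P_def by (rule restr_subset[OF bd])
  finally show "P * (laplacian vs es s * K) = transpose_mat ?Q" .
qed

section \<open>The Neumann-Poincare operator and its spectrum\<close>

text \<open>The Laplacian is linear in the conductivity, so the mean of the two conormal derivatives
  is a single Laplacian with weight \<open>t\<close>, restricted to \<open>bd\<close>.\<close>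

lemma neumann_poincare_eq:
  assumes "pp \<in> carrier_vec (length es)" "pm \<in> carrier_vec (length es)" "\<sigma> \<in> carrier_vec (length es)"
    and "dim_row (single_layer vs es \<sigma> B bd) = length vs"
    and t: "\<And>k. k < length es \<Longrightarrow> t $ k = (pm $ k - pp $ k) / 2 * \<sigma> $ k"
  shows "neumann_poincare vs es \<sigma> B bd pp pm
    = restr vs bd * laplacian vs es t * single_layer vs es \<sigma> B bd"
proof -
  let ?L = "laplacian vs es" and ?K = "single_layer vs es \<sigma> B bd"
  let ?M = "gamma1_plus vs es \<sigma> bd pp + gamma1_minus vs es \<sigma> bd pm"
  have lin: "?L t $$ (i, j) = (?L (cmult_vec pm \<sigma>) $$ (i, j) - ?L (cmult_vec pp \<sigma>) $$ (i, j)) / 2"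
    if "i < length vs" "j < length vs" for i j
    unfolding laplacian_index[OF that] sum_subtractf[symmetric] sum_divide_distrib
  proof (rule sum.cong)
    fix k assume "k \<in> {..<length es}"
    then have k: "k < length es" by simp
    have c: "cmult_vec p \<sigma> $ k = p $ k * \<sigma> $ k" for p
      using k assms(3) by (simp add: cmult_vec_def)
    show "t $ k * (grad vs es $$ (k, i) * grad vs es $$ (k, j))
        = (cmult_vec pm \<sigma> $ k * (grad vs es $$ (k, i) * grad vs es $$ (k, j))
          - cmult_vec pp \<sigma> $ k * (grad vs es $$ (k, i) * grad vs es $$ (k, j))) / 2"
      unfolding c t[OF k] by (simp add: algebra_simps diff_divide_distrib)
  qed simp
  have M: "?M \<in> carrier_mat (card (vertex_indices vs bd)) (length vs)"
    by (auto simp: gamma1_plus_def gamma1_minus_def)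
  have "(1 / 2) \<cdot>\<^sub>m ?M = restr vs bd * ?L t"
    by (rule eq_matI)
      (simp_all add: gamma1_plus_def gamma1_minus_def restr_mult_index lin pick_vertex_indices
        diff_divide_distrib del: index_mult_mat(1))
  moreover have "(1 / 2) \<cdot>\<^sub>m (?M * ?K) = ((1 / 2) \<cdot>\<^sub>m ?M) * ?K"
    using assms(4) by (intro mult_smult_assoc_mat[OF M, symmetric]) (rule carrier_matI, simp_all)
  ultimately show ?thesis unfolding neumann_poincare_def by simp
qed

theorem lemma4p4:
  fixes G :: "'a pair_pre_digraph" and vs :: "'a list" and es :: "('a \<times> 'a) list"
    and B Op bd Om :: "'a set" and \<sigma> pp pm :: "real Matrix.vec"
  assumes "pair_graph G" and "Digraph_Component.connected (with_proj G)"
    and "vertex_enum G vs" and "edge_enum G es"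
    and "partition4 G B Op bd Om"
    and "\<sigma> \<in> carrier_vec (length es)" and "\<forall>k<length es. \<sigma> $ k > 0"
    and "pp \<in> carrier_vec (length es)" and "\<forall>k<length es. 0 \<le> pp $ k \<and> pp $ k \<le> 1"
    and "pm \<in> carrier_vec (length es)" and "\<forall>k<length es. 0 \<le> pm $ k \<and> pm $ k \<le> 1"
    and "\<forall>k<length es. pp $ k + pm $ k = 1"
    and "\<forall>k<length es. edge_touches es k (B \<union> Op) \<longrightarrow> pp $ k = 1"
    and "\<forall>k<length es. edge_touches es k Om \<longrightarrow> pm $ k = 1"
  shows "spectrum (map_mat complex_of_real (neumann_poincare vs es \<sigma> B bd pp pm)) \<subseteq> \<real>"
proof -
  define t where "t = Matrix.vec (length es) (\<lambda>k. (pm $ k - pp $ k) / 2 * \<sigma> $ k)"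
  define K where "K = single_layer vs es \<sigma> B bd"
  define Q where "Q = restr vs bd"
  define L where "L = laplacian vs es"
  define g where "g = grad vs es"
  define P where "P = transpose_mat (restr vs (set vs - B)) * restr vs (set vs - B)"
  define T where "T = neumann_poincare vs es \<sigma> B bd pp pm"
  define H where "H = g * K"
  let ?n = "length vs" and ?m = "length es" and ?q = "card (vertex_indices vs bd)"
  have part: "B \<union> Op \<union> bd \<union> Om = set vs" "B \<noteq> {}" "B \<inter> bd = {}"
    using assms(3,5) by (auto simp: partition4_def vertex_enum_def)
  have B: "B \<inter> pverts G \<noteq> {}" and bd: "bd \<subseteq> set vs - B"
    using part assms(3) by (auto simp: vertex_enum_def)
  note K_facts = laplacian_mult_single_layer[OF assms(1-4) B bd, of \<sigma>, folded P_def K_def Q_def L_def]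
  have PLK: "P * (L \<sigma> * K) = transpose_mat Q" and PK: "P * K = K"
    and dK: "dim_row K = ?n" "dim_col K = ?q"
    using K_facts assms(7) by (auto simp: K_def single_layer_def gamma0_def)
  have dims [simp]: "dim_row Q = ?q" "dim_col Q = ?n" "dim_row (L s) = ?n" "dim_col (L s) = ?n"
    "dim_row g = ?m" "dim_col g = ?n" "dim_row P = ?n" "dim_col P = ?n" "dim_row H = ?m" "dim_col H = ?q" for s
    by (auto simp: Q_def L_def g_def P_def H_def dK)
  note [simp] = dK
  have P: "P = mat_diag ?n (\<lambda>j. of_bool (vs ! j \<in> set vs - B))"
    unfolding P_def by (rule restr_proj)
  have Pt: "transpose_mat P = P" unfolding P by (rule eq_matI) (auto simp: mat_diag_def)
  have QQ: "transpose_mat Q * Q = mat_diag ?n (\<lambda>j. of_bool (vs ! j \<in> bd))"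
    unfolding Q_def by (rule restr_proj)
  have "transpose_mat (P * K) = transpose_mat K * transpose_mat P"
    by (rule transpose_mult[of _ ?n ?n _ ?q]) auto
  then have KP: "transpose_mat K = transpose_mat K * P"
    unfolding PK Pt .
  have T: "T = Q * (L t * K)"
    using neumann_poincare_eq[OF assms(8,10,6), of vs B bd t] dK
    by (simp add: T_def K_def[symmetric] Q_def L_def t_def mult_mat_assoc)
  have gram: "transpose_mat H * mat_diag ?m (\<lambda>k. s $ k) * H = transpose_mat K * (L s * K)" for s
  proof -
    have "transpose_mat H = transpose_mat K * transpose_mat g"
      unfolding H_def by (rule transpose_mult[of _ ?m ?n _ ?q]) auto
    then show ?thesis
      unfolding H_def L_def laplacian_def g_def[symmetric] by (simp add: mult_mat_assoc)
  qed
  \<comment> \<open>The two diagonal projections differ exactly at vertices outside both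
    \<open>B\<close> and \<open>bd\<close>, so it suffices that row \<open>i\<close> of
    \<open>L t * K\<close> vanishes there.\<close>
  have row: "(P * (L t * K)) $$ (i, j) = (transpose_mat Q * Q * (L t * K)) $$ (i, j)"
    if ij: "i < ?n" "j < ?q" for i j
  proof -
    let ?M = "L t * K"
    have M: "?M \<in> carrier_mat ?n ?q" by auto
    have PM: "(P * ?M) $$ (i, j) = of_bool (vs ! i \<in> set vs - B) * ?M $$ (i, j)"
      unfolding P mat_diag_mult_left[OF M] using ij by simp
    have QM: "(transpose_mat Q * Q * ?M) $$ (i, j) = of_bool (vs ! i \<in> bd) * ?M $$ (i, j)"
      unfolding QQ mat_diag_mult_left[OF M] using ij by simp
    have "?M $$ (i, j) = 0" if out: "vs ! i \<notin> B" "vs ! i \<notin> bd"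
    proof -
      have "vs ! i \<in> Op \<or> vs ! i \<in> Om" using part out ij nth_mem by blast
      then have "\<exists>c. \<forall>k<?m. fst (es ! k) = vs ! i \<or> snd (es ! k) = vs ! i \<longrightarrow> t $ k = c * \<sigma> $ k"
      proof
        assume Op: "vs ! i \<in> Op"
        \<comment> \<open>Every edge at a vertex of \<open>Op\<close> has \<open>pp = 1\<close> and
          hence \<open>pm = 0\<close>.\<close>
        have "t $ k = (-1/2) * \<sigma> $ k"
          if "k < ?m" "fst (es ! k) = vs ! i \<or> snd (es ! k) = vs ! i" for k
        proof -
          have "pp $ k = 1" using assms(13) that Op by (auto simp: edge_touches_def)
          moreover have "pm $ k = 0" using assms(12) that calculation by force
          ultimately show ?thesis using that by (simp add: t_def)
        qed
        then show ?thesis by blast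
      next
        assume Om: "vs ! i \<in> Om"
        \<comment> \<open>At a vertex of \<open>Om\<close> the roles of \<open>pp\<close> and
          \<open>pm\<close> are exchanged, which flips the sign.\<close>
        have "t $ k = (1/2) * \<sigma> $ k"
          if "k < ?m" "fst (es ! k) = vs ! i \<or> snd (es ! k) = vs ! i" for k
        proof -
          have "pm $ k = 1" using assms(14) that Om by (auto simp: edge_touches_def)
          moreover have "pp $ k = 0" using assms(12) that calculation by force
          ultimately show ?thesis using that by (simp add: t_def)
        qed
        then show ?thesis by blast
      qed
      then obtain c where
        c: "\<forall>k<?m. fst (es ! k) = vs ! i \<or> snd (es ! k) = vs ! i \<longrightarrow> t $ k = c * \<sigma> $ k" by blast
      then have "L t $$ (i, l) = c * L \<sigma> $$ (i, l)" if "l < ?n" for l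
        unfolding L_def using ij that by (intro laplacian_row_eq) auto
      then have "?M $$ (i, j) = c * (L \<sigma> * K) $$ (i, j)"
        using ij by (simp add: scalar_prod_def sum_distrib_left mult.assoc)
      \<comment> \<open>\<open>P\<close> fixes row \<open>i\<close> because \<open>vs ! i\<close> is
        not in \<open>B\<close>. After its insertion \<open>PLK\<close> applies, and the transpose
        of \<open>Q\<close> has zero rows outside \<open>bd\<close>.\<close>
      also have "(L \<sigma> * K) $$ (i, j) = (P * (L \<sigma> * K)) $$ (i, j)"
        unfolding P using ij out
        by (subst mat_diag_mult_left[of _ _ ?q]) (auto simp del: index_mult_mat(1))
      also have "\<dots> = Q $$ (j, i)" using PLK ij by simp
      also have "\<dots> = 0"
        using ij out pick_vertex_indices(2)[of j vs bd] by (auto simp: Q_def restr_index)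
      finally show ?thesis by simp
    qed
    then show ?thesis unfolding PM QM using ij bd by auto
  qed
  have loc: "P * (L t * K) = transpose_mat Q * T"
  proof -
    have "P * (L t * K) = transpose_mat Q * Q * (L t * K)"
      by (rule eq_matI) (use row in \<open>simp_all del: index_mult_mat(1)\<close>)
    then show ?thesis by (simp add: T mult_mat_assoc)
  qed
  \<comment> \<open>The columns of \<open>K\<close> vanish on \<open>B\<close>, so \<open>P\<close>
    may be inserted for free; this makes \<open>loc\<close> and \<open>PLK\<close>, which hold only
    after projection, usable.\<close>
  have Kleft: "transpose_mat K * X = transpose_mat K * (P * X)" if "dim_row X = ?n" for X
    using that by (subst KP) (simp add: mult_mat_assoc)
  have Tc: "T \<in> carrier_mat ?q ?q" by (auto simp: T)
  have "transpose_mat K * (L t * K) = transpose_mat K * (L \<sigma> * K) * T"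
    using Kleft[of "L t * K"] Kleft[of "L \<sigma> * K"] Tc by (simp add: loc PLK mult_mat_assoc)
  then have cong: "transpose_mat H * mat_diag ?m (\<lambda>k. t $ k) * H
      = transpose_mat H * mat_diag ?m (\<lambda>k. \<sigma> $ k) * H * T"
    by (simp add: gram)
  \<comment> \<open>A left inverse of \<open>H\<close>: the weights complete the gradient to
    \<open>L \<sigma>\<close>, and \<open>PLK\<close> reduces \<open>W * H\<close> to
    \<open>Q\<close> times its transpose.\<close>
  define W where "W = Q * P * transpose_mat g * mat_diag ?m (\<lambda>k. \<sigma> $ k)"
  have "W * H = Q * (P * (L \<sigma> * K))"
    by (simp add: W_def H_def L_def laplacian_def g_def[symmetric] mult_mat_assoc)
  then have "W * H = 1\<^sub>m ?q"
    unfolding PLK by (simp add: Q_def restr_mult_restr_transpose)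
  then show ?thesis
    unfolding T_def[symmetric]
    using assms(7) cong Tc
    by (intro spectrum_real_of_congruence[of H ?m ?q T W "\<lambda>k. \<sigma> $ k" "\<lambda>k. t $ k"])
      (auto simp: W_def)
qed

end
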